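(* The inclusion functor $\mathbf{IQuant}\to\mathbf{OSR}_{\mathrm{sa}}$, sending an integral quantale $(Q,\leq,1,\cdot)$ to the ordered semiring $(Q,\leq,\bot,1,\vee,\cdot)$ and a quantale homomorphism to itself, has a left adjoint $\mathrm{Idl}\colon\mathbf{OSR}_{\mathrm{sa}}\to\mathbf{IQuant}$, which sends each ordered semiring $A$ to the integral quantale $\mathrm{Idl}(A)$ of ideals of $A$.
   Context: Semirings are commutative and unital: $(A,0,+)$ and $(A,1,\cdot)$ are commutative monoids with $x\cdot 0=0$ and $x(y+z)=xy+xz$. An ordered semiring is a tuple $(A,\leq,0,1,+,\cdot)$ where $(A,0,1,+,\cdot)$ is a semiring and $\leq$ is a preorder on $A$ with respect to which $+$ and $\cdot$ are monotone. A subadditive morphism $f\colon A\to B$ between ordered semirings is a monotone function with $f(0_A)\leq 0_B$, $f(1_A)=1_B$, $f(x+y)\leq f(x)+f(y)$ and $f(xy)=f(x)f(y)$ for all $x,y\in A$. $\mathbf{OSR}_{\mathrm{sa}}$ is the category of ordered semirings and subadditive morphisms. A quantale (always unital and commutative) is a tuple $(Q,\leq,1,\cdot)$ where $(Q,\leq)$ is a complete lattice (poset), $(Q,1,\cdot)$ is a commutative monoid, and $x\cdot\bigvee_\lambda y_\lambda=\bigvee_\lambda x\cdot y_\lambda$ for all families $(y_\lambda)$ in $Q$. It is integral if $1$ is the largest element. A quantale homomorphism is a function preserving arbitrary joins, the unit and the multiplication. $\mathbf{IQuant}$ is the category of integral quantales and quantale homomorphisms. An ideal of an ordered semiring $A$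 is a subset $I\subseteq A$ such that: $x\leq y\in I$ implies $x\in I$; $0\in I$; $x,y\in I$ implies $x+y\in I$; and if $x\in I$ or $y\in I$ then $xy\in I$. For $S\subseteq A$, $\langle S\rangle$ denotes the smallest ideal containing $S$. $\mathrm{Idl}(A)$ is the set of all ideals of $A$; ordered by inclusion, with multiplication $I\cdot J=\langle\{xy\mid x\in I,y\in J\}\rangle$ and unit $A$, it is an integral quantale. *)

theory Defs
  imports "HOL-Library.FuncSet" "HOL-Algebra.Ring" "HOL-Algebra.Complete_Lattice"
begin

section \<open>Ordered semirings and subadditive morphisms\<close>

record 'a osr = "'a ring" +
  osr_le :: "'a \<Rightarrow> 'a \<Rightarrow> bool" (infix \<open>\<preceq>\<index>\<close> 50)

locale ordered_semiring = semiring A + comm_monoid A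
  for A :: "'a osr" (structure) +
  assumes osr_refl: "x \<in> carrier A \<Longrightarrow> x \<preceq> x"
    and osr_trans: "\<lbrakk>x \<in> carrier A; y \<in> carrier A; z \<in> carrier A; x \<preceq> y; y \<preceq> z\<rbrakk> \<Longrightarrow> x \<preceq> z"
    and add_mono: "\<lbrakk>x \<in> carrier A; x' \<in> carrier A; y \<in> carrier A; y' \<in> carrier A;
                    x \<preceq> x'; y \<preceq> y'\<rbrakk> \<Longrightarrow> x \<oplus> y \<preceq> x' \<oplus> y'"
    and mult_mono: "\<lbrakk>x \<in> carrier A; x' \<in> carrier A; y \<in> carrier A; y' \<in> carrier A;
                    x \<preceq> x'; y \<preceq> y'\<rbrakk> \<Longrightarrow> x \<otimes> y \<preceq> x' \<otimes> y'"

text \<open>Morphisms of both categories are extensional functions on the carrier, so that HOL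
  equality of functions is equality of morphisms; composition is \<^const>\<open>compose\<close> and identities
  are restrictions of the identity. Hom-sets are polymorphic: source and target may live over
  different types.\<close>

definition osr_sa_hom :: "'a osr \<Rightarrow> 'b osr \<Rightarrow> ('a \<Rightarrow> 'b) set" where
  "osr_sa_hom A B = {f \<in> carrier A \<rightarrow>\<^sub>E carrier B.
     (\<forall>x\<in>carrier A. \<forall>y\<in>carrier A. x \<preceq>\<^bsub>A\<^esub> y \<longrightarrow> f x \<preceq>\<^bsub>B\<^esub> f y) \<and>
     f \<zero>\<^bsub>A\<^esub> \<preceq>\<^bsub>B\<^esub> \<zero>\<^bsub>B\<^esub> \<and>
     f \<one>\<^bsub>A\<^esub> = \<one>\<^bsub>B\<^esub> \<and>
     (\<forall>x\<in>carrier A. \<forall>y\<in>carrier A. f (x \<oplus>\<^bsub>A\<^esub> y) \<preceq>\<^bsub>B\<^esub> f x \<oplus>\<^bsub>B\<^esub> f y) \<and>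
     (\<forall>x\<in>carrier A. \<forall>y\<in>carrier A. f (x \<otimes>\<^bsub>A\<^esub> y) = f x \<otimes>\<^bsub>B\<^esub> f y)}"

abbreviation identity_on :: "'a set \<Rightarrow> 'a \<Rightarrow> 'a" where
  "identity_on X \<equiv> (\<lambda>x\<in>X. x)"

lemma osr_sa_hom_identity:
  assumes "ordered_semiring A"
  shows "identity_on (carrier A) \<in> osr_sa_hom A A"
proof -
  interpret ordered_semiring A by fact
  show ?thesis by (auto simp: osr_sa_hom_def intro: osr_refl)
qed

lemma osr_sa_hom_compose:
  assumes "ordered_semiring A" "ordered_semiring B" "ordered_semiring C"
    and f: "f \<in> osr_sa_hom A B" and g: "g \<in> osr_sa_hom B C"
  shows "compose (carrier A) g f \<in> osr_sa_hom A C"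
proof -
  interpret A: ordered_semiring A by fact
  interpret B: ordered_semiring B by fact
  interpret C: ordered_semiring C by fact
  have fc: "f x \<in> carrier B" if "x \<in> carrier A" for x
    using f that by (auto simp: osr_sa_hom_def)
  have gc: "g x \<in> carrier C" if "x \<in> carrier B" for x
    using g that by (auto simp: osr_sa_hom_def)
  have gm: "g x \<preceq>\<^bsub>C\<^esub> g y" if "x \<in> carrier B" "y \<in> carrier B" "x \<preceq>\<^bsub>B\<^esub> y" for x y
    using g that by (auto simp: osr_sa_hom_def)
  have z: "g (f \<zero>\<^bsub>A\<^esub>) \<preceq>\<^bsub>C\<^esub> \<zero>\<^bsub>C\<^esub>"
    by (rule C.osr_trans[of _ "g \<zero>\<^bsub>B\<^esub>"])
      (use f g in \<open>auto intro!: gc fc gm simp: osr_sa_hom_def\<close>)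
  have a: "g (f (x \<oplus>\<^bsub>A\<^esub> y)) \<preceq>\<^bsub>C\<^esub> g (f x) \<oplus>\<^bsub>C\<^esub> g (f y)"
    if "x \<in> carrier A" "y \<in> carrier A" for x y
    by (rule C.osr_trans[of _ "g (f x \<oplus>\<^bsub>B\<^esub> f y)"])
      (use f g that in \<open>auto intro!: gc fc gm simp: osr_sa_hom_def\<close>)
  show ?thesis
    using f g z a fc by (auto simp: osr_sa_hom_def compose_def)
qed

section \<open>Integral quantales\<close>

record 'a quant = "'a monoid" +
  quant_le :: "'a \<Rightarrow> 'a \<Rightarrow> bool"

definition quant_order :: "'a quant \<Rightarrow> 'a gorder" where
  "quant_order Q = \<lparr>carrier = carrier Q, eq = (=), le = quant_le Q\<rparr>"

text \<open>Distributivity is stated for subsets instead of families; the join of a family is the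
  join of its range.\<close>

locale quantale = comm_monoid Q
  for Q :: "'a quant" (structure) +
  assumes complete: "complete_lattice (quant_order Q)"
    and mult_join: "\<lbrakk>x \<in> carrier Q; Y \<subseteq> carrier Q\<rbrakk> \<Longrightarrow>
      x \<otimes> (\<Squnion>\<^bsub>quant_order Q\<^esub> Y) = \<Squnion>\<^bsub>quant_order Q\<^esub> ((\<lambda>y. x \<otimes> y) ` Y)"

locale integral_quantale = quantale +
  assumes le_one: "x \<in> carrier Q \<Longrightarrow> quant_le Q x \<one>"

definition iquant_hom :: "'a quant \<Rightarrow> 'b quant \<Rightarrow> ('a \<Rightarrow> 'b) set" where
  "iquant_hom P Q = {h \<in> carrier P \<rightarrow>\<^sub>E carrier Q.
     (\<forall>S. S \<subseteq> carrier P \<longrightarrow> h (\<Squnion>\<^bsub>quant_order P\<^esub> S) = \<Squnion>\<^bsub>quant_order Q\<^esub> (h ` S)) \<and>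
     h \<one>\<^bsub>P\<^esub> = \<one>\<^bsub>Q\<^esub> \<and>
     (\<forall>x\<in>carrier P. \<forall>y\<in>carrier P. h (x \<otimes>\<^bsub>P\<^esub> y) = h x \<otimes>\<^bsub>Q\<^esub> h y)}"

lemma quant_join_closed:
  assumes "quantale Q" "S \<subseteq> carrier Q"
  shows "\<Squnion>\<^bsub>quant_order Q\<^esub> S \<in> carrier Q"
proof -
  interpret complete_lattice "quant_order Q" using assms(1) by (rule quantale.complete)
  show ?thesis using sup_closed[of S] assms(2) by (simp add: quant_order_def)
qed

lemma iquant_hom_identity:
  assumes "integral_quantale Q"
  shows "identity_on (carrier Q) \<in> iquant_hom Q Q"
proof -
  interpret integral_quantale Q by fact
  have "identity_on (carrier Q) ` S = S" if "S \<subseteq> carrier Q" for S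
    using that by force
  then show ?thesis
    by (auto simp: iquant_hom_def quant_join_closed[OF quantale_axioms])
qed

lemma iquant_hom_compose:
  assumes "integral_quantale P" "integral_quantale Q" "integral_quantale R"
    and h: "h \<in> iquant_hom P Q" and k: "k \<in> iquant_hom Q R"
  shows "compose (carrier P) k h \<in> iquant_hom P R"
proof -
  interpret P: integral_quantale P by fact
  have hc: "h x \<in> carrier Q" if "x \<in> carrier P" for x
    using h that by (auto simp: iquant_hom_def)
  have "compose (carrier P) k h (\<Squnion>\<^bsub>quant_order P\<^esub> S) = \<Squnion>\<^bsub>quant_order R\<^esub> (compose (carrier P) k h ` S)"
    if S: "S \<subseteq> carrier P" for S
  proof -
    have hS: "h ` S \<subseteq> carrier Q" using hc S by auto
    have "compose (carrier P) k h ` S = k ` h ` S"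
      unfolding image_image using S by (intro image_cong) (auto simp: compose_eq)
    moreover have "k (h (\<Squnion>\<^bsub>quant_order P\<^esub> S)) = \<Squnion>\<^bsub>quant_order R\<^esub> (k ` h ` S)"
      using h k S hS by (simp add: iquant_hom_def)
    ultimately show ?thesis
      using quant_join_closed[OF P.quantale_axioms S] by (simp add: compose_eq)
  qed
  then show ?thesis
    using h k hc by (auto simp: iquant_hom_def compose_eq) (simp add: compose_def)
qed

section \<open>The inclusion functor on objects\<close>

definition osr_of_quant :: "'a quant \<Rightarrow> 'a osr" where
  "osr_of_quant Q = \<lparr>carrier = carrier Q, mult = mult Q, one = one Q,
     zero = \<bottom>\<^bsub>quant_order Q\<^esub>, add = (\<lambda>x y. x \<squnion>\<^bsub>quant_order Q\<^esub> y), osr_le = quant_le Q\<rparr>"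

section \<open>The quantale of ideals\<close>

definition osr_ideal :: "'a osr \<Rightarrow> 'a set \<Rightarrow> bool" where
  "osr_ideal A I \<longleftrightarrow> I \<subseteq> carrier A \<and>
     (\<forall>x\<in>carrier A. \<forall>y\<in>I. x \<preceq>\<^bsub>A\<^esub> y \<longrightarrow> x \<in> I) \<and>
     \<zero>\<^bsub>A\<^esub> \<in> I \<and>
     (\<forall>x\<in>I. \<forall>y\<in>I. x \<oplus>\<^bsub>A\<^esub> y \<in> I) \<and>
     (\<forall>x\<in>carrier A. \<forall>y\<in>carrier A. x \<in> I \<or> y \<in> I \<longrightarrow> x \<otimes>\<^bsub>A\<^esub> y \<in> I)"

definition osr_genideal :: "'a osr \<Rightarrow> 'a set \<Rightarrow> 'a set" where
  "osr_genideal A S = \<Inter>{I. osr_ideal A I \<and> S \<subseteq> I}"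

definition Idl :: "'a osr \<Rightarrow> 'a set quant" where
  "Idl A = \<lparr>carrier = {I. osr_ideal A I},
     mult = (\<lambda>I J. osr_genideal A {x \<otimes>\<^bsub>A\<^esub> y | x y. x \<in> I \<and> y \<in> J}),
     one = carrier A, quant_le = (\<subseteq>)\<rparr>"

definition Idl_map :: "'a osr \<Rightarrow> 'b osr \<Rightarrow> ('a \<Rightarrow> 'b) \<Rightarrow> 'a set \<Rightarrow> 'b set" where
  "Idl_map A B f = (\<lambda>I\<in>carrier (Idl A). osr_genideal B (f ` I))"

text \<open>The unit of the adjunction, and the transposition of a quantale homomorphism
  \<open>h : Idl A \<rightarrow> Q\<close> to a subadditive morphism from \<open>A\<close> to the image of \<open>Q\<close> under the inclusion.\<close>

definition Idl_unit :: "'a osr \<Rightarrow> 'a \<Rightarrow> 'a set" where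
  "Idl_unit A = (\<lambda>a\<in>carrier A. osr_genideal A {a})"

definition Idl_transpose :: "'a osr \<Rightarrow> ('a set \<Rightarrow> 'q) \<Rightarrow> 'a \<Rightarrow> 'q" where
  "Idl_transpose A h = compose (carrier A) h (Idl_unit A)"

end

theory Submission
  imports Defs
begin

text \<open>Two preimage facts carry the proof. The preimage of an ideal under a subadditive morphism
  is an ideal, and a principal down-set \<open>{x. x \<le> q}\<close> of an integral quantale is an ideal
  (integrality gives \<open>x y \<le> x\<close>). Hence for a subadditive \<open>f : A \<rightarrow> Q\<close> the bound
  \<open>f s \<le> q\<close> on a set \<open>S\<close> extends to the ideal generated by \<open>S\<close>, so that
  \<open>\<Squnion> (f ` \<langle>S\<rangle>) = \<Squnion> (f ` S)\<close>. The extension \<open>I \<mapsto> \<Squnion> (f ` I)\<close> is therefore a quantale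
  homomorphism \<open>Idl A \<rightarrow> Q\<close>, and it is the only one with transpose \<open>f\<close>, because every
  ideal is the join of its principal subideals.\<close>

section \<open>Joins in quantales\<close>

lemma quant_order_simps [simp]:
  "carrier (quant_order Q) = carrier Q"
  "le (quant_order Q) = quant_le Q"
  "eq (quant_order Q) = (=)"
  by (simp_all add: quant_order_def)

lemma osr_of_quant_simps [simp]:
  "carrier (osr_of_quant Q) = carrier Q"
  "mult (osr_of_quant Q) = mult Q"
  "one (osr_of_quant Q) = one Q"
  "zero (osr_of_quant Q) = \<bottom>\<^bsub>quant_order Q\<^esub>"
  "add (osr_of_quant Q) = (\<lambda>x y. x \<squnion>\<^bsub>quant_order Q\<^esub> y)"
  "osr_le (osr_of_quant Q) = quant_le Q"
  by (simp_all add: osr_of_quant_def)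

context quantale
begin

interpretation L: complete_lattice "quant_order Q"
  by (rule complete)

lemma quant_refl: "x \<in> carrier Q \<Longrightarrow> quant_le Q x x"
  using L.le_refl by simp

lemma quant_trans:
  "\<lbrakk>quant_le Q x y; quant_le Q y z; x \<in> carrier Q; y \<in> carrier Q; z \<in> carrier Q\<rbrakk>
    \<Longrightarrow> quant_le Q x z"
  using L.le_trans[of x y z] by simp

lemma quant_antisym:
  "\<lbrakk>quant_le Q x y; quant_le Q y x; x \<in> carrier Q; y \<in> carrier Q\<rbrakk> \<Longrightarrow> x = y"
  using L.le_antisym[of x y] by simp

lemma join_closed: "S \<subseteq> carrier Q \<Longrightarrow> \<Squnion>\<^bsub>quant_order Q\<^esub> S \<in> carrier Q"
  by (rule quant_join_closed[OF quantale_axioms])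

lemma join_upper: "\<lbrakk>S \<subseteq> carrier Q; x \<in> S\<rbrakk> \<Longrightarrow> quant_le Q x (\<Squnion>\<^bsub>quant_order Q\<^esub> S)"
  using L.sup_upper[of S x] by simp

lemma join_least:
  "\<lbrakk>S \<subseteq> carrier Q; z \<in> carrier Q; \<And>x. x \<in> S \<Longrightarrow> quant_le Q x z\<rbrakk>
    \<Longrightarrow> quant_le Q (\<Squnion>\<^bsub>quant_order Q\<^esub> S) z"
  using L.sup_least[of S z] by simp

text \<open>A least upper bound in a poset is unique, so an equation between joins reduces to
  comparing upper bounds. Most join computations below go this way.\<close>

lemma join_eqI:
  assumes "S \<subseteq> carrier Q" "z \<in> carrier Q" "\<And>x. x \<in> S \<Longrightarrow> quant_le Q x z"
    and "\<And>u. \<lbrakk>u \<in> carrier Q; \<And>x. x \<in> S \<Longrightarrow> quant_le Q x u\<rbrakk> \<Longrightarrow> quant_le Q z u"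
  shows "\<Squnion>\<^bsub>quant_order Q\<^esub> S = z"
proof (rule quant_antisym)
  show "quant_le Q z (\<Squnion>\<^bsub>quant_order Q\<^esub> S)"
    by (rule assms(4)) (use assms(1) join_closed join_upper in auto)
qed (use assms in \<open>auto intro: join_least join_closed\<close>)

lemma bottom_eq_join: "\<bottom>\<^bsub>quant_order Q\<^esub> = \<Squnion>\<^bsub>quant_order Q\<^esub> {}"
  using L.weak_sup_empty by simp

text \<open>Monotonicity is extracted from distributivity: b \<le> c means that c is the join of
  \<open>{b, c}\<close>, and multiplying this join by a exhibits a c as an upper bound of a b.
  Commutativity then handles the other factor.\<close>

lemma mult_le_mono:
  assumes "x \<in> carrier Q" "x' \<in> carrier Q" "y \<in> carrier Q" "y' \<in> carrier Q"
    and "quant_le Q x x'" "quant_le Q y y'"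
  shows "quant_le Q (x \<otimes> y) (x' \<otimes> y')"
proof -
  have le: "quant_le Q (a \<otimes> b) (a \<otimes> c)"
    if "a \<in> carrier Q" "b \<in> carrier Q" "c \<in> carrier Q" "quant_le Q b c" for a b c
  proof -
    have "\<Squnion>\<^bsub>quant_order Q\<^esub> {b, c} = c"
      by (rule join_eqI) (use that in \<open>auto intro: quant_refl\<close>)
    then have "a \<otimes> c = \<Squnion>\<^bsub>quant_order Q\<^esub> {a \<otimes> b, a \<otimes> c}"
      using mult_join[of a "{b, c}"] that by simp
    then show ?thesis
      using join_upper[of "{a \<otimes> b, a \<otimes> c}" "a \<otimes> b"] that by simp
  qed
  have "quant_le Q (x \<otimes> y) (x \<otimes> y')" "quant_le Q (y' \<otimes> x) (y' \<otimes> x')"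
    using le assms by auto
  then show ?thesis
    using assms quant_trans[of "x \<otimes> y" "x \<otimes> y'" "x' \<otimes> y'"] by (simp add: m_comm)
qed

text \<open>Distributivity is applied once in each variable. This form matches the product of ideals
  and later makes the extension of a subadditive morphism multiplicative.\<close>

lemma join_mult_join:
  assumes X: "X \<subseteq> carrier Q" and Y: "Y \<subseteq> carrier Q"
  shows "\<Squnion>\<^bsub>quant_order Q\<^esub> X \<otimes> \<Squnion>\<^bsub>quant_order Q\<^esub> Y
    = \<Squnion>\<^bsub>quant_order Q\<^esub> {x \<otimes> y | x y. x \<in> X \<and> y \<in> Y}"
proof (rule sym, rule join_eqI)
  let ?x = "\<Squnion>\<^bsub>quant_order Q\<^esub> X" and ?y = "\<Squnion>\<^bsub>quant_order Q\<^esub> Y"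
  have x: "?x \<in> carrier Q" and y: "?y \<in> carrier Q"
    using X Y join_closed by auto
  show "{x \<otimes> y | x y. x \<in> X \<and> y \<in> Y} \<subseteq> carrier Q" "?x \<otimes> ?y \<in> carrier Q"
    using X Y x y by auto
  show "quant_le Q z (?x \<otimes> ?y)" if "z \<in> {x \<otimes> y | x y. x \<in> X \<and> y \<in> Y}" for z
    using that X Y x y by (auto intro!: mult_le_mono join_upper)
  fix u
  assume u: "u \<in> carrier Q"
    and ub: "\<And>z. z \<in> {x \<otimes> y | x y. x \<in> X \<and> y \<in> Y} \<Longrightarrow> quant_le Q z u"
  have "quant_le Q (a \<otimes> ?y) u" if "a \<in> X" for a
  proof -
    have "quant_le Q (\<Squnion>\<^bsub>quant_order Q\<^esub> ((\<lambda>b. a \<otimes> b) ` Y)) u"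
      by (rule join_least) (use X Y u that in \<open>auto intro!: ub\<close>)
    then show ?thesis
      using mult_join[of a Y] X Y that by auto
  qed
  \<comment> \<open>Swapping the factors puts the fixed element \<open>?y\<close> on the left, where
    \<open>mult_join\<close> can distribute it over \<open>X\<close>.\<close>
  then have "quant_le Q (?y \<otimes> a) u" if "a \<in> X" for a
    using m_comm[of ?y a] X y that by (simp add: subset_iff)
  then have "quant_le Q (\<Squnion>\<^bsub>quant_order Q\<^esub> ((\<lambda>a. ?y \<otimes> a) ` X)) u"
    by (intro join_least) (use X y u in auto)
  then show "quant_le Q (?x \<otimes> ?y) u"
    using mult_join[of ?y X] m_comm[of ?x ?y] X x y by simp
qed

text \<open>The axioms linking the two operations are instances of \<open>mult_join\<close>: a pair
  yields distributivity over binary joins, and the empty set yields that the bottom element is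
  absorbing.\<close>

lemma ordered_semiring_osr_of_quant: "ordered_semiring (osr_of_quant Q)"
proof -
  have distr: "x \<otimes> (y \<squnion>\<^bsub>quant_order Q\<^esub> z) = (x \<otimes> y) \<squnion>\<^bsub>quant_order Q\<^esub> (x \<otimes> z)"
    if "x \<in> carrier Q" "y \<in> carrier Q" "z \<in> carrier Q" for x y z
    using mult_join[of x "{y, z}"] that by (simp add: join_def)
  have null: "x \<otimes> \<bottom>\<^bsub>quant_order Q\<^esub> = \<bottom>\<^bsub>quant_order Q\<^esub>" if "x \<in> carrier Q" for x
    using mult_join[of x "{}"] that by (simp add: bottom_eq_join)
  have bot: "\<bottom>\<^bsub>quant_order Q\<^esub> \<in> carrier Q"
    using L.bottom_closed by simp
  have jc: "x \<squnion>\<^bsub>quant_order Q\<^esub> y \<in> carrier Q" if "x \<in> carrier Q" "y \<in> carrier Q" for x y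
    using L.join_closed that by simp
  have comm: "x \<squnion>\<^bsub>quant_order Q\<^esub> y = y \<squnion>\<^bsub>quant_order Q\<^esub> x" for x y
    by (simp add: join_def insert_commute)
  have unit: "\<bottom>\<^bsub>quant_order Q\<^esub> \<squnion>\<^bsub>quant_order Q\<^esub> x = x" if "x \<in> carrier Q" for x
    unfolding join_def
    by (rule join_eqI) (use that bot L.bottom_lower in \<open>auto intro: quant_refl\<close>)
  have add_mono: "quant_le Q (x \<squnion>\<^bsub>quant_order Q\<^esub> y) (x' \<squnion>\<^bsub>quant_order Q\<^esub> y')"
    if "x \<in> carrier Q" "x' \<in> carrier Q" "y \<in> carrier Q" "y' \<in> carrier Q"
      "quant_le Q x x'" "quant_le Q y y'" for x x' y y'
    using that L.join_le[of x "x' \<squnion>\<^bsub>quant_order Q\<^esub> y'" y] L.join_left[of x' y'] L.join_right[of x' y']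
      L.join_closed[of x' y'] L.le_trans[of x x' "x' \<squnion>\<^bsub>quant_order Q\<^esub> y'"]
      L.le_trans[of y y' "x' \<squnion>\<^bsub>quant_order Q\<^esub> y'"]
    by simp
  have assoc: "x \<squnion>\<^bsub>quant_order Q\<^esub> y \<squnion>\<^bsub>quant_order Q\<^esub> z = x \<squnion>\<^bsub>quant_order Q\<^esub> (y \<squnion>\<^bsub>quant_order Q\<^esub> z)"
    if "x \<in> carrier Q" "y \<in> carrier Q" "z \<in> carrier Q" for x y z
    using L.join_assoc[of x y z] that by simp
  have "abelian_monoid (osr_of_quant Q)"
    by (rule abelian_monoidI) (use jc bot assoc unit comm in auto)
  moreover have "comm_monoid (osr_of_quant Q)"
    by (rule comm_monoidI) (auto simp: m_assoc intro: m_comm)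
  ultimately show ?thesis
    unfolding ordered_semiring_def semiring_def ordered_semiring_axioms_def semiring_axioms_def
    using distr null jc bot
    by (auto simp: comm_monoid.axioms m_comm intro: quant_refl quant_trans add_mono mult_le_mono)
qed

end

section \<open>Quantale homomorphisms as subadditive morphisms\<close>

lemma iquant_hom_closed: "\<lbrakk>h \<in> iquant_hom P Q; x \<in> carrier P\<rbrakk> \<Longrightarrow> h x \<in> carrier Q"
  by (auto simp: iquant_hom_def)

lemma iquant_hom_join:
  "\<lbrakk>h \<in> iquant_hom P Q; S \<subseteq> carrier P\<rbrakk>
    \<Longrightarrow> h (\<Squnion>\<^bsub>quant_order P\<^esub> S) = \<Squnion>\<^bsub>quant_order Q\<^esub> (h ` S)"
  by (auto simp: iquant_hom_def)

text \<open>If x \<le> y then y is the join of \<open>{x, y}\<close>; preserving this join puts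
  \<open>h x\<close> below \<open>h y\<close>.\<close>

lemma iquant_hom_mono:
  assumes "quantale P" "quantale Q" and h: "h \<in> iquant_hom P Q"
    and "x \<in> carrier P" "y \<in> carrier P" "quant_le P x y"
  shows "quant_le Q (h x) (h y)"
proof -
  interpret P: quantale P by fact
  interpret Q: quantale Q by fact
  have "\<Squnion>\<^bsub>quant_order P\<^esub> {x, y} = y"
    by (rule P.join_eqI) (use assms in \<open>auto intro: P.quant_refl\<close>)
  then have "h y = \<Squnion>\<^bsub>quant_order Q\<^esub> {h x, h y}"
    using iquant_hom_join[OF h, of "{x, y}"] assms by simp
  then show ?thesis
    using Q.join_upper[of "{h x, h y}" "h x"] assms iquant_hom_closed[OF h] by simp
qed

text \<open>Zero and addition of the associated semiring are the joins of the empty set and of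
  pairs. A homomorphism preserves both with equality, so the required inequalities hold by
  reflexivity.\<close>

lemma iquant_hom_subset_osr_sa_hom:
  assumes "quantale P" "quantale Q"
  shows "iquant_hom P Q \<subseteq> osr_sa_hom (osr_of_quant P) (osr_of_quant Q)"
proof
  interpret P: quantale P by fact
  interpret Q: quantale Q by fact
  interpret oQ: ordered_semiring "osr_of_quant Q" by (rule Q.ordered_semiring_osr_of_quant)
  fix h assume h: "h \<in> iquant_hom P Q"
  have "h (\<bottom>\<^bsub>quant_order P\<^esub>) = \<bottom>\<^bsub>quant_order Q\<^esub>"
    using iquant_hom_join[OF h, of "{}"] by (simp add: P.bottom_eq_join Q.bottom_eq_join)
  moreover have "h (x \<squnion>\<^bsub>quant_order P\<^esub> y) = h x \<squnion>\<^bsub>quant_order Q\<^esub> h y"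
    if "x \<in> carrier P" "y \<in> carrier P" for x y
    using iquant_hom_join[OF h, of "{x, y}"] that by (simp add: join_def)
  moreover have "\<bottom>\<^bsub>quant_order Q\<^esub> \<in> carrier Q"
    using oQ.zero_closed by simp
  moreover have "x \<squnion>\<^bsub>quant_order Q\<^esub> y \<in> carrier Q" if "x \<in> carrier Q" "y \<in> carrier Q" for x y
    using oQ.add.m_closed that by simp
  ultimately show "h \<in> osr_sa_hom (osr_of_quant P) (osr_of_quant Q)"
    using h iquant_hom_mono[OF assms h] iquant_hom_closed[OF h]
    by (auto simp: iquant_hom_def osr_sa_hom_def intro: Q.quant_refl)
qed

section \<open>The quantale of ideals\<close>

lemma Idl_simps [simp]:
  "carrier (Idl A) = {I. osr_ideal A I}"
  "mult (Idl A) I J = osr_genideal A {x \<otimes>\<^bsub>A\<^esub> y | x y. x \<in> I \<and> y \<in> J}"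
  "one (Idl A) = carrier A"
  "quant_le (Idl A) = (\<subseteq>)"
  by (simp_all add: Idl_def)

lemma osr_ideal_subset: "osr_ideal A I \<Longrightarrow> I \<subseteq> carrier A"
  by (simp add: osr_ideal_def)

lemma osr_ideal_le: "\<lbrakk>osr_ideal A I; y \<in> I; x \<in> carrier A; x \<preceq>\<^bsub>A\<^esub> y\<rbrakk> \<Longrightarrow> x \<in> I"
  unfolding osr_ideal_def by blast

lemma osr_ideal_add: "\<lbrakk>osr_ideal A I; x \<in> I; y \<in> I\<rbrakk> \<Longrightarrow> x \<oplus>\<^bsub>A\<^esub> y \<in> I"
  unfolding osr_ideal_def by blast

lemma osr_ideal_zero: "osr_ideal A I \<Longrightarrow> \<zero>\<^bsub>A\<^esub> \<in> I"
  unfolding osr_ideal_def by blast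

lemma osr_ideal_mult: "\<lbrakk>osr_ideal A I; x \<in> I; y \<in> carrier A\<rbrakk> \<Longrightarrow> x \<otimes>\<^bsub>A\<^esub> y \<in> I"
  unfolding osr_ideal_def by blast

lemma subset_osr_genideal: "S \<subseteq> osr_genideal A S"
  by (auto simp: osr_genideal_def)

lemma osr_genideal_least: "\<lbrakk>osr_ideal A J; S \<subseteq> J\<rbrakk> \<Longrightarrow> osr_genideal A S \<subseteq> J"
  by (auto simp: osr_genideal_def)

lemma osr_genideal_ideal: "osr_ideal A I \<Longrightarrow> osr_genideal A I = I"
  by (simp add: osr_genideal_least subset_osr_genideal subset_antisym)

lemma osr_sa_hom_closed: "\<lbrakk>f \<in> osr_sa_hom A B; x \<in> carrier A\<rbrakk> \<Longrightarrow> f x \<in> carrier B"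
  by (auto simp: osr_sa_hom_def)

context ordered_semiring
begin

lemma osr_ideal_carrier: "osr_ideal A (carrier A)"
  by (auto simp: osr_ideal_def)

lemma osr_ideal_Inter:
  assumes "F \<noteq> {}" "\<And>I. I \<in> F \<Longrightarrow> osr_ideal A I"
  shows "osr_ideal A (\<Inter>F)"
  using assms unfolding osr_ideal_def by blast

text \<open>If \<open>S\<close> leaves the carrier, no ideal contains it and the defining
  intersection is \<open>UNIV\<close>. For \<open>S\<close> inside the carrier, the family contains
  \<open>carrier A\<close>, so this is an intersection of a nonempty family of ideals.\<close>

lemma osr_ideal_genideal: "S \<subseteq> carrier A \<Longrightarrow> osr_ideal A (osr_genideal A S)"
  unfolding osr_genideal_def using osr_ideal_carrier by (intro osr_ideal_Inter) auto

lemma osr_genideal_mono: "\<lbrakk>S \<subseteq> T; T \<subseteq> carrier A\<rbrakk> \<Longrightarrow> osr_genideal A S \<subseteq> osr_genideal A T"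
  by (meson order_trans osr_genideal_least osr_ideal_genideal subset_osr_genideal)

text \<open>This is the ideal quotient (J : T). Being an ideal, it lets a condition on products with
  elements of \<open>T\<close> pass from generators to the ideal they generate.\<close>

lemma osr_ideal_colon:
  assumes J: "osr_ideal A J" and T: "T \<subseteq> carrier A"
  shows "osr_ideal A {x \<in> carrier A. \<forall>y\<in>T. x \<otimes> y \<in> J}" (is "osr_ideal A ?K")
proof -
  have down: "x \<in> ?K" if x: "x \<in> carrier A" and z: "z \<in> ?K" and "x \<preceq> z" for x z
  proof -
    have "x \<otimes> y \<in> J" if y: "y \<in> T" for y
    proof (rule osr_ideal_le[OF J])
      have "y \<in> carrier A" using y T by auto
      then show "x \<otimes> y \<in> carrier A" "x \<otimes> y \<preceq> z \<otimes> y"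
        using x z \<open>x \<preceq> z\<close> by (simp_all add: mult_mono osr_refl)
      show "z \<otimes> y \<in> J" using z y by simp
    qed
    then show ?thesis using x by simp
  qed
  have mult: "x \<otimes> z \<in> ?K" if x: "x \<in> ?K" and z: "z \<in> carrier A" for x z
  proof -
    have "x \<otimes> z \<otimes> y \<in> J" if y: "y \<in> T" for y
    proof -
      have "y \<in> carrier A" using y T by auto
      then have "x \<otimes> z \<otimes> y = x \<otimes> y \<otimes> z" using x z by (simp add: m_ac)
      then show ?thesis using osr_ideal_mult[OF J, of "x \<otimes> y" z] x y z by simp
    qed
    then show ?thesis using x z by simp
  qed
  have zero: "\<zero> \<in> ?K"
    using osr_ideal_zero[OF J] T by (auto dest: subsetD)
  have add: "x \<oplus> z \<in> ?K" if x: "x \<in> ?K" and z: "z \<in> ?K" for x z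
  proof -
    have "(x \<oplus> z) \<otimes> y \<in> J" if y: "y \<in> T" for y
    proof -
      have "y \<in> carrier A" using y T by auto
      then have "(x \<oplus> z) \<otimes> y = x \<otimes> y \<oplus> z \<otimes> y" using x z by (simp add: l_distr)
      then show ?thesis using osr_ideal_add[OF J] x y z by simp
    qed
    then show ?thesis using x z by simp
  qed
  show ?thesis
    unfolding osr_ideal_def
  proof (intro conjI ballI impI)
    show "x \<otimes> z \<in> ?K" if "x \<in> carrier A" "z \<in> carrier A" "x \<in> ?K \<or> z \<in> ?K" for x z
      using that mult[of x z] mult[of z x] m_comm[of x z] by auto
  qed (fact zero down add | blast)+
qed

text \<open>Two quotients are used in turn: \<open>S\<close> lies in (J : T), hence so does every
  \<open>x\<close> in its generated ideal; then \<open>T\<close> lies in (J : x), hence so does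
  every \<open>y\<close> in its generated ideal.\<close>

lemma osr_genideal_mult_mem:
  assumes J: "osr_ideal A J" and S: "S \<subseteq> carrier A" and T: "T \<subseteq> carrier A"
    and ST: "\<And>x y. \<lbrakk>x \<in> S; y \<in> T\<rbrakk> \<Longrightarrow> x \<otimes> y \<in> J"
    and x: "x \<in> osr_genideal A S" and y: "y \<in> osr_genideal A T"
  shows "x \<otimes> y \<in> J"
proof -
  have xS: "x \<otimes> t \<in> J" "x \<in> carrier A" if "t \<in> T" for t
    using osr_genideal_least[OF osr_ideal_colon[OF J T], of S] S ST x that by auto
  \<comment> \<open>This is established separately because \<open>xS\<close> yields nothing when
    \<open>T\<close> is empty.\<close>
  have xc: "x \<in> carrier A"
    using osr_ideal_subset[OF osr_ideal_genideal[OF S]] x by auto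
  have "T \<subseteq> {z \<in> carrier A. \<forall>s\<in>{x}. z \<otimes> s \<in> J}"
    using T xS xc by (auto simp: m_comm subset_iff)
  then have "y \<otimes> x \<in> J" "y \<in> carrier A"
    using osr_genideal_least[OF osr_ideal_colon[OF J, of "{x}"], of T] xc y by auto
  then show ?thesis using xc by (simp add: m_comm)
qed

text \<open>Products of ideals can be computed on generators. Associativity and distributivity in
  \<open>Idl A\<close> thereby reduce to statements about sets of elementwise products.\<close>

lemma osr_genideal_mult:
  assumes S: "S \<subseteq> carrier A" and T: "T \<subseteq> carrier A"
  shows "osr_genideal A S \<otimes>\<^bsub>Idl A\<^esub> osr_genideal A T = osr_genideal A {x \<otimes> y | x y. x \<in> S \<and> y \<in> T}"
proof -
  let ?ST = "{x \<otimes> y | x y. x \<in> S \<and> y \<in> T}"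
  let ?P = "{x \<otimes> y | x y. x \<in> osr_genideal A S \<and> y \<in> osr_genideal A T}"
  have "?ST \<subseteq> carrier A" using S T by auto
  then have J: "osr_ideal A (osr_genideal A ?ST)" by (rule osr_ideal_genideal)
  have "?P \<subseteq> osr_genideal A ?ST"
    using osr_genideal_mult_mem[OF J S T] subset_osr_genideal[of ?ST A] by blast
  then have "osr_genideal A ?P \<subseteq> osr_genideal A ?ST"
    by (rule osr_genideal_least[OF J])
  moreover have "osr_genideal A ?ST \<subseteq> osr_genideal A ?P"
  proof (rule osr_genideal_mono)
    show "?ST \<subseteq> ?P"
      using subset_osr_genideal[of S A] subset_osr_genideal[of T A] by blast
    show "?P \<subseteq> carrier A"
      using osr_ideal_subset[OF osr_ideal_genideal[OF S]]
        osr_ideal_subset[OF osr_ideal_genideal[OF T]] by auto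
  qed
  ultimately show ?thesis by simp
qed

section \<open>The complete lattice of ideals\<close>

lemma partial_order_Idl: "partial_order (quant_order (Idl A))"
  by unfold_locales auto

lemma Idl_lub:
  assumes F: "F \<subseteq> carrier (Idl A)"
  shows "least (quant_order (Idl A)) (osr_genideal A (\<Union>F)) (Upper (quant_order (Idl A)) F)"
proof (rule least_UpperI)
  have U: "\<Union>F \<subseteq> carrier A" using F osr_ideal_subset by fastforce
  show "F \<subseteq> carrier (quant_order (Idl A))" using F by simp
  show "osr_genideal A (\<Union>F) \<in> carrier (quant_order (Idl A))"
    using osr_ideal_genideal[OF U] by simp
  show "I \<sqsubseteq>\<^bsub>quant_order (Idl A)\<^esub> osr_genideal A (\<Union>F)" if "I \<in> F" for I
    using that subset_osr_genideal[of "\<Union>F" A] by auto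
  show "osr_genideal A (\<Union>F) \<sqsubseteq>\<^bsub>quant_order (Idl A)\<^esub> J" if "J \<in> Upper (quant_order (Idl A)) F" for J
    using that F osr_genideal_least[of A J "\<Union>F"] by (auto simp: Upper_def)
qed

lemma complete_lattice_Idl: "complete_lattice (quant_order (Idl A))"
proof -
  interpret partial_order "quant_order (Idl A)" by (rule partial_order_Idl)
  have glb: "\<exists>I. greatest (quant_order (Idl A)) I (Lower (quant_order (Idl A)) F)"
    if F: "F \<subseteq> carrier (quant_order (Idl A))" for F
  proof
    \<comment> \<open>Inserting \<open>carrier A\<close> makes the intersection over an empty family
      the largest ideal instead of \<open>UNIV\<close>.\<close>
    have "osr_ideal A (\<Inter>(insert (carrier A) F))"
      by (rule osr_ideal_Inter) (use F osr_ideal_carrier in auto)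
    then show "greatest (quant_order (Idl A)) (\<Inter>(insert (carrier A) F)) (Lower (quant_order (Idl A)) F)"
      using F by (intro greatest_LowerI) (auto simp: Lower_def dest: osr_ideal_subset)
  qed
  show ?thesis
    by unfold_locales (use Idl_lub glb in auto)
qed

text \<open>The lattice join is only specified as some least upper bound; uniqueness in a partial
  order identifies it with the one built in \<open>Idl_lub\<close>.\<close>

lemma Idl_join:
  assumes "F \<subseteq> carrier (Idl A)"
  shows "\<Squnion>\<^bsub>quant_order (Idl A)\<^esub> F = osr_genideal A (\<Union>F)"
proof -
  interpret complete_lattice "quant_order (Idl A)" by (rule complete_lattice_Idl)
  have F: "F \<subseteq> carrier (quant_order (Idl A))" using assms by simp
  show ?thesis
    using weak_least_unique[OF sup_lub[OF F] Idl_lub[OF assms]] by simp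
qed

section \<open>Multiplication of ideals\<close>

lemma comm_monoid_Idl: "comm_monoid (Idl A)"
proof (rule comm_monoidI)
  let ?p = "\<lambda>I J. {x \<otimes> y | x y. x \<in> I \<and> y \<in> J}"
  have sub: "?p I J \<subseteq> carrier A" if "I \<subseteq> carrier A" "J \<subseteq> carrier A" for I J
    using that by auto
  show "I \<otimes>\<^bsub>Idl A\<^esub> J \<in> carrier (Idl A)" if "I \<in> carrier (Idl A)" "J \<in> carrier (Idl A)" for I J
    using that by (auto intro!: osr_ideal_genideal sub dest: osr_ideal_subset)
  show "\<one>\<^bsub>Idl A\<^esub> \<in> carrier (Idl A)"
    by (simp add: osr_ideal_carrier)
  show "I \<otimes>\<^bsub>Idl A\<^esub> J = J \<otimes>\<^bsub>Idl A\<^esub> I" if "I \<in> carrier (Idl A)" "J \<in> carrier (Idl A)" for I J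
  proof -
    have "?p I J = ?p J I"
      using that osr_ideal_subset[of A I] osr_ideal_subset[of A J] m_comm
      by (auto simp: subset_iff) metis+
    then show ?thesis by simp
  qed
  show "\<one>\<^bsub>Idl A\<^esub> \<otimes>\<^bsub>Idl A\<^esub> I = I" if "I \<in> carrier (Idl A)" for I
  proof -
    have I: "osr_ideal A I" using that by simp
    have "?p (carrier A) I = I"
    proof
      show "?p (carrier A) I \<subseteq> I"
        using I osr_ideal_subset[OF I] unfolding osr_ideal_def by blast
      have "i = \<one> \<otimes> i" if "i \<in> I" for i
        using that osr_ideal_subset[OF I] by auto
      then show "I \<subseteq> ?p (carrier A) I" by blast
    qed
    then show ?thesis using osr_genideal_ideal[OF I] by simp
  qed
  show "I \<otimes>\<^bsub>Idl A\<^esub> J \<otimes>\<^bsub>Idl A\<^esub> K = I \<otimes>\<^bsub>Idl A\<^esub> (J \<otimes>\<^bsub>Idl A\<^esub> K)"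
    if "I \<in> carrier (Idl A)" "J \<in> carrier (Idl A)" "K \<in> carrier (Idl A)" for I J K
  proof -
    \<comment> \<open>Each factor that is an ideal equals the ideal it generates, so
      \<open>osr_genideal_mult\<close> turns both bracketings into ideals generated by triple
      products, which agree by associativity in \<open>A\<close>.\<close>
    have I: "osr_ideal A I" "I \<subseteq> carrier A" and J: "osr_ideal A J" "J \<subseteq> carrier A"
      and K: "osr_ideal A K" "K \<subseteq> carrier A"
      using that osr_ideal_subset by auto
    have "I \<otimes>\<^bsub>Idl A\<^esub> J \<otimes>\<^bsub>Idl A\<^esub> K = osr_genideal A (?p (?p I J) K)"
      using osr_genideal_mult[OF sub[OF I(2) J(2)] K(2)] osr_genideal_ideal[OF K(1)] by simp
    moreover have "I \<otimes>\<^bsub>Idl A\<^esub> (J \<otimes>\<^bsub>Idl A\<^esub> K) = osr_genideal A (?p I (?p J K))"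
      using osr_genideal_mult[OF I(2) sub[OF J(2) K(2)]] osr_genideal_ideal[OF I(1)] by simp
    moreover have "?p (?p I J) K = ?p I (?p J K)"
    proof (rule Set.set_eqI, rule iffI)
      fix z assume "z \<in> ?p (?p I J) K"
      then obtain i j k where "i \<in> I" "j \<in> J" "k \<in> K" "z = i \<otimes> j \<otimes> k" by blast
      then show "z \<in> ?p I (?p J K)"
        using m_assoc[of i j k] I J K by blast
    next
      fix z assume "z \<in> ?p I (?p J K)"
      then obtain i j k where "i \<in> I" "j \<in> J" "k \<in> K" "z = i \<otimes> (j \<otimes> k)" by blast
      moreover from this have "z = i \<otimes> j \<otimes> k"
        using m_assoc[of i j k] I J K by (simp add: subset_iff)
      ultimately show "z \<in> ?p (?p I J) K" by blast
    qed
    ultimately show ?thesis by simp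
  qed
qed

text \<open>Both sides of the distributive law are generated by the products of elements of
  \<open>I\<close> with elements of the union of \<open>F\<close>. Integrality says that every ideal
  lies in the carrier.\<close>

lemma integral_quantale_Idl: "integral_quantale (Idl A)"
proof -
  interpret M: comm_monoid "Idl A" by (rule comm_monoid_Idl)
  have "I \<otimes>\<^bsub>Idl A\<^esub> (\<Squnion>\<^bsub>quant_order (Idl A)\<^esub> F) = \<Squnion>\<^bsub>quant_order (Idl A)\<^esub> ((\<lambda>J. I \<otimes>\<^bsub>Idl A\<^esub> J) ` F)"
    if I: "I \<in> carrier (Idl A)" and F: "F \<subseteq> carrier (Idl A)" for I F
  proof -
    let ?p = "\<lambda>J. {x \<otimes> y | x y. x \<in> I \<and> y \<in> J}"
    have Ic: "I \<subseteq> carrier A" and Fc: "\<Union>F \<subseteq> carrier A"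
      using I F osr_ideal_subset by fastforce+
    have mF: "(\<lambda>J. I \<otimes>\<^bsub>Idl A\<^esub> J) ` F \<subseteq> carrier (Idl A)"
      using I F M.m_closed by blast
    have "I \<otimes>\<^bsub>Idl A\<^esub> (\<Squnion>\<^bsub>quant_order (Idl A)\<^esub> F) = osr_genideal A (?p (\<Union>F))"
      using osr_genideal_mult[OF Ic Fc] osr_genideal_ideal[of A I] I by (simp add: Idl_join[OF F])
    also have "\<dots> = osr_genideal A (\<Union>J\<in>F. I \<otimes>\<^bsub>Idl A\<^esub> J)"
    proof
      have sub: "(\<Union>J\<in>F. I \<otimes>\<^bsub>Idl A\<^esub> J) \<subseteq> carrier A"
        using mF osr_ideal_subset by fastforce
      have p: "?p J \<subseteq> I \<otimes>\<^bsub>Idl A\<^esub> J" for J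
        using subset_osr_genideal[of "?p J"] by simp
      have "?p (\<Union>F) \<subseteq> (\<Union>J\<in>F. I \<otimes>\<^bsub>Idl A\<^esub> J)"
      proof
        fix z assume "z \<in> ?p (\<Union>F)"
        then obtain J where "J \<in> F" "z \<in> ?p J" by blast
        then show "z \<in> (\<Union>J\<in>F. I \<otimes>\<^bsub>Idl A\<^esub> J)" using p by blast
      qed
      then show "osr_genideal A (?p (\<Union>F)) \<subseteq> osr_genideal A (\<Union>J\<in>F. I \<otimes>\<^bsub>Idl A\<^esub> J)"
        using sub by (rule osr_genideal_mono)
      have pc: "?p (\<Union>F) \<subseteq> carrier A" using Ic Fc by auto
      have "I \<otimes>\<^bsub>Idl A\<^esub> J \<subseteq> osr_genideal A (?p (\<Union>F))" if "J \<in> F" for J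
        unfolding Idl_simps by (rule osr_genideal_mono) (use that pc in auto)
      then show "osr_genideal A (\<Union>J\<in>F. I \<otimes>\<^bsub>Idl A\<^esub> J) \<subseteq> osr_genideal A (?p (\<Union>F))"
        by (intro osr_genideal_least osr_ideal_genideal pc) auto
    qed
    finally show ?thesis by (simp only: Idl_join[OF mF])
  qed
  then show ?thesis
    unfolding integral_quantale_def quantale_def integral_quantale_axioms_def quantale_axioms_def
    using comm_monoid_Idl complete_lattice_Idl by (auto simp del: Idl_simps(2) dest: osr_ideal_subset)
qed

end

section \<open>The adjunction\<close>

text \<open>Inequalities for zero and sums suffice because \<open>J\<close> is closed downwards.
  Absorption uses that \<open>f\<close> is exactly multiplicative.\<close>

lemma osr_ideal_vimage:
  assumes "ordered_semiring A" "ordered_semiring B"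
    and f: "f \<in> osr_sa_hom A B" and J: "osr_ideal B J"
  shows "osr_ideal A {x \<in> carrier A. f x \<in> J}"
proof -
  interpret A: ordered_semiring A by fact
  interpret B: ordered_semiring B by fact
  note fc = osr_sa_hom_closed[OF f]
  have mono: "f x \<preceq>\<^bsub>B\<^esub> f y" if "x \<in> carrier A" "y \<in> carrier A" "x \<preceq>\<^bsub>A\<^esub> y" for x y
    using f that by (auto simp: osr_sa_hom_def)
  have zero: "f \<zero>\<^bsub>A\<^esub> \<preceq>\<^bsub>B\<^esub> \<zero>\<^bsub>B\<^esub>"
    using f by (auto simp: osr_sa_hom_def)
  have add: "f (x \<oplus>\<^bsub>A\<^esub> y) \<preceq>\<^bsub>B\<^esub> f x \<oplus>\<^bsub>B\<^esub> f y"
    and mult: "f (x \<otimes>\<^bsub>A\<^esub> y) = f x \<otimes>\<^bsub>B\<^esub> f y"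
    if "x \<in> carrier A" "y \<in> carrier A" for x y
    using f that by (auto simp: osr_sa_hom_def)
  have z: "f \<zero>\<^bsub>A\<^esub> \<in> J"
    using osr_ideal_le[OF J osr_ideal_zero[OF J] fc zero] by simp
  have a: "f (x \<oplus>\<^bsub>A\<^esub> y) \<in> J" if "x \<in> carrier A" "y \<in> carrier A" "f x \<in> J" "f y \<in> J" for x y
    using osr_ideal_le[OF J osr_ideal_add[OF J that(3,4)] fc add] that by simp
  have m: "f (x \<otimes>\<^bsub>A\<^esub> y) \<in> J" "f (y \<otimes>\<^bsub>A\<^esub> x) \<in> J"
    if "x \<in> carrier A" "y \<in> carrier A" "f x \<in> J" for x y
    using osr_ideal_mult[OF J that(3) fc[OF that(2)]] that by (simp_all add: mult A.m_comm)
  show ?thesis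
    unfolding osr_ideal_def using z a m osr_ideal_le[OF J _ fc mono] by auto
qed

lemma image_osr_genideal_subset:
  assumes "ordered_semiring A" "ordered_semiring B"
    and f: "f \<in> osr_sa_hom A B" and J: "osr_ideal B J"
    and S: "S \<subseteq> carrier A" "f ` S \<subseteq> J"
  shows "f ` osr_genideal A S \<subseteq> J"
  using osr_genideal_least[OF osr_ideal_vimage[OF assms(1,2) f J], of S] S by auto

text \<open>Closing up before applying \<open>f\<close> adds nothing after closing up again. Both
  the composition law for \<open>Idl_map\<close> and naturality in the semiring rest on
  this.\<close>

lemma osr_genideal_image_genideal:
  assumes "ordered_semiring A" "ordered_semiring B"
    and f: "f \<in> osr_sa_hom A B" and S: "S \<subseteq> carrier A"
  shows "osr_genideal B (f ` osr_genideal A S) = osr_genideal B (f ` S)"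
proof
  interpret A: ordered_semiring A by fact
  interpret B: ordered_semiring B by fact
  have G: "osr_ideal B (osr_genideal B (f ` S))"
    using osr_sa_hom_closed[OF f] S by (intro B.osr_ideal_genideal) auto
  then show "osr_genideal B (f ` osr_genideal A S) \<subseteq> osr_genideal B (f ` S)"
    by (intro osr_genideal_least image_osr_genideal_subset[OF assms(1,2) f] S subset_osr_genideal)
  show "osr_genideal B (f ` S) \<subseteq> osr_genideal B (f ` osr_genideal A S)"
    using osr_sa_hom_closed[OF f] osr_ideal_subset[OF A.osr_ideal_genideal[OF S]]
    by (intro B.osr_genideal_mono image_mono subset_osr_genideal) auto
qed

lemma (in integral_quantale) osr_ideal_downset:
  assumes q: "q \<in> carrier Q"
  shows "osr_ideal (osr_of_quant Q) {x \<in> carrier Q. quant_le Q x q}"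
proof -
  \<comment> \<open>Integrality enters here: comparing \<open>y\<close> with the unit bounds the
    product by q 1 = q.\<close>
  have mult: "quant_le Q (x \<otimes> y) q" if "x \<in> carrier Q" "y \<in> carrier Q" "quant_le Q x q" for x y
    using mult_le_mono[of x q y \<one>] that q le_one by simp
  moreover have "quant_le Q (y \<otimes> x) q"
    if "x \<in> carrier Q" "y \<in> carrier Q" "quant_le Q x q" for x y
    using mult[OF that] that by (simp add: m_comm)
  moreover have "x \<squnion>\<^bsub>quant_order Q\<^esub> y \<in> carrier Q \<and> quant_le Q (x \<squnion>\<^bsub>quant_order Q\<^esub> y) q"
    if "x \<in> carrier Q" "y \<in> carrier Q" "quant_le Q x q" "quant_le Q y q" for x y
    unfolding join_def using that q by (auto intro!: join_closed join_least)
  moreover have "\<bottom>\<^bsub>quant_order Q\<^esub> \<in> carrier Q \<and> quant_le Q \<bottom>\<^bsub>quant_order Q\<^esub> q"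
    unfolding bottom_eq_join using q by (auto intro!: join_closed join_least)
  ultimately show ?thesis
    unfolding osr_ideal_def using q quant_trans by auto
qed

lemma join_image_osr_genideal:
  assumes "ordered_semiring A" "integral_quantale Q"
    and f: "f \<in> osr_sa_hom A (osr_of_quant Q)" and S: "S \<subseteq> carrier A"
  shows "\<Squnion>\<^bsub>quant_order Q\<^esub> (f ` osr_genideal A S) = \<Squnion>\<^bsub>quant_order Q\<^esub> (f ` S)"
proof -
  interpret A: ordered_semiring A by fact
  interpret Q: integral_quantale Q by fact
  note fc = osr_sa_hom_closed[OF f, simplified]
  have fS: "f ` S \<subseteq> carrier Q" using fc S by auto
  \<comment> \<open>The preimage argument is applied to the down-set of the join over
    \<open>S\<close>, which contains the values of \<open>f\<close> on \<open>S\<close> by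
    construction.\<close>
  have G: "f ` osr_genideal A S \<subseteq> {x \<in> carrier Q. quant_le Q x (\<Squnion>\<^bsub>quant_order Q\<^esub> (f ` S))}"
    by (rule image_osr_genideal_subset[OF assms(1) Q.ordered_semiring_osr_of_quant f])
      (use fS S in \<open>auto intro: Q.osr_ideal_downset Q.join_closed Q.join_upper\<close>)
  show ?thesis
  proof (rule Q.join_eqI)
    fix u
    assume u: "u \<in> carrier Q" and ub: "\<And>x. x \<in> f ` osr_genideal A S \<Longrightarrow> quant_le Q x u"
    show "quant_le Q (\<Squnion>\<^bsub>quant_order Q\<^esub> (f ` S)) u"
      by (rule Q.join_least[OF fS u]) (use ub subset_osr_genideal[of S A] in auto)
  qed (use G fS Q.join_closed in auto)
qed

section \<open>Extending a subadditive morphism to ideals\<close>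

definition idl_extend :: "'a osr \<Rightarrow> 'q quant \<Rightarrow> ('a \<Rightarrow> 'q) \<Rightarrow> 'a set \<Rightarrow> 'q" where
  "idl_extend A Q f = (\<lambda>I\<in>carrier (Idl A). \<Squnion>\<^bsub>quant_order Q\<^esub> (f ` I))"

text \<open>Joins and products in \<open>Idl A\<close> are generated ideals, so evaluating on
  generators is what shows that the extension preserves them.\<close>

lemma idl_extend_genideal:
  assumes "ordered_semiring A" "integral_quantale Q"
    and "f \<in> osr_sa_hom A (osr_of_quant Q)" "S \<subseteq> carrier A"
  shows "idl_extend A Q f (osr_genideal A S) = \<Squnion>\<^bsub>quant_order Q\<^esub> (f ` S)"
  using join_image_osr_genideal[OF assms] ordered_semiring.osr_ideal_genideal[OF assms(1,4)]
  by (simp add: idl_extend_def)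

lemma idl_extend_iquant_hom:
  assumes "ordered_semiring A" "integral_quantale Q"
    and f: "f \<in> osr_sa_hom A (osr_of_quant Q)"
  shows "idl_extend A Q f \<in> iquant_hom (Idl A) Q"
proof -
  interpret A: ordered_semiring A by fact
  interpret Q: integral_quantale Q by fact
  note fc = osr_sa_hom_closed[OF f, simplified]
  let ?h = "idl_extend A Q f"
  have h: "?h I = \<Squnion>\<^bsub>quant_order Q\<^esub> (f ` I)" if "osr_ideal A I" for I
    using that by (simp add: idl_extend_def)
  have img: "f ` I \<subseteq> carrier Q" if "I \<subseteq> carrier A" for I
    using that fc by auto
  have hc: "?h I \<in> carrier Q" if "osr_ideal A I" for I
    using that by (simp add: h Q.join_closed img osr_ideal_subset)
  have join: "?h (\<Squnion>\<^bsub>quant_order (Idl A)\<^esub> F) = \<Squnion>\<^bsub>quant_order Q\<^esub> (?h ` F)"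
    if F: "F \<subseteq> carrier (Idl A)" for F
  proof -
    have U: "\<Union>F \<subseteq> carrier A" using F osr_ideal_subset by fastforce
    have hF: "?h ` F \<subseteq> carrier Q" using F hc by auto
    have "\<Squnion>\<^bsub>quant_order Q\<^esub> (f ` \<Union>F) = \<Squnion>\<^bsub>quant_order Q\<^esub> (?h ` F)"
    \<comment> \<open>A join over a union is the join of the joins over its members.\<close>
    proof (rule Q.join_eqI)
      show "f ` \<Union>F \<subseteq> carrier Q" by (rule img[OF U])
      show "\<Squnion>\<^bsub>quant_order Q\<^esub> (?h ` F) \<in> carrier Q" by (rule Q.join_closed[OF hF])
    next
      fix x assume "x \<in> f ` \<Union>F"
      then obtain I where I: "I \<in> F" "x \<in> f ` I" by auto
      then have Ii: "osr_ideal A I" using F by auto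
      have "quant_le Q x (?h I)"
        using I img[OF osr_ideal_subset[OF Ii]] by (simp add: h[OF Ii] Q.join_upper)
      moreover have "quant_le Q (?h I) (\<Squnion>\<^bsub>quant_order Q\<^esub> (?h ` F))"
        using I hF by (intro Q.join_upper) auto
      moreover have "x \<in> carrier Q" using I img[OF osr_ideal_subset[OF Ii]] by auto
      ultimately show "quant_le Q x (\<Squnion>\<^bsub>quant_order Q\<^esub> (?h ` F))"
        using Q.quant_trans hc[OF Ii] Q.join_closed[OF hF] by blast
    next
      fix u
      assume u: "u \<in> carrier Q" and ub: "\<And>x. x \<in> f ` \<Union>F \<Longrightarrow> quant_le Q x u"
      have "quant_le Q (?h I) u" if "I \<in> F" for I
      proof -
        have Ii: "osr_ideal A I" using F that by auto
        show ?thesis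
          unfolding h[OF Ii]
          by (rule Q.join_least[OF img[OF osr_ideal_subset[OF Ii]] u]) (use ub that in auto)
      qed
      then show "quant_le Q (\<Squnion>\<^bsub>quant_order Q\<^esub> (?h ` F)) u"
        by (intro Q.join_least[OF hF u]) auto
    qed
    then show ?thesis
      using idl_extend_genideal[OF assms U] by (simp add: A.Idl_join[OF F])
  qed
  \<comment> \<open>The unit of \<open>Q\<close> is a value of \<open>f\<close>, namely at the unit
    of \<open>A\<close>, and integrality makes it an upper bound of all values.\<close>
  have one: "?h (carrier A) = \<one>\<^bsub>Q\<^esub>"
    unfolding h[OF A.osr_ideal_carrier]
  proof (rule Q.join_eqI)
    have "\<one>\<^bsub>Q\<^esub> = f \<one>\<^bsub>A\<^esub>" using f by (simp add: osr_sa_hom_def)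
    then have "\<one>\<^bsub>Q\<^esub> \<in> f ` carrier A" by auto
    then show "quant_le Q \<one>\<^bsub>Q\<^esub> u" if "\<And>x. x \<in> f ` carrier A \<Longrightarrow> quant_le Q x u" for u
      using that by auto
  qed (use fc Q.le_one in auto)
  have mult: "?h (I \<otimes>\<^bsub>Idl A\<^esub> J) = ?h I \<otimes>\<^bsub>Q\<^esub> ?h J" if I: "osr_ideal A I" and J: "osr_ideal A J" for I J
  proof -
    let ?p = "{x \<otimes>\<^bsub>A\<^esub> y | x y. x \<in> I \<and> y \<in> J}"
    have "f (x \<otimes>\<^bsub>A\<^esub> y) = f x \<otimes>\<^bsub>Q\<^esub> f y" if "x \<in> I" "y \<in> J" for x y
      using f that osr_ideal_subset[OF I] osr_ideal_subset[OF J]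
      by (simp add: osr_sa_hom_def subset_iff)
    \<comment> \<open>The values on products are the products of values, so
      \<open>join_mult_join\<close> splits their join into two factors.\<close>
    then have "f ` ?p = {a \<otimes>\<^bsub>Q\<^esub> b | a b. a \<in> f ` I \<and> b \<in> f ` J}"
      by (auto simp: image_iff) metis+
    moreover have "?p \<subseteq> carrier A"
      using osr_ideal_subset[OF I] osr_ideal_subset[OF J] by auto
    ultimately show ?thesis
      using Q.join_mult_join[OF img img, OF osr_ideal_subset[OF I] osr_ideal_subset[OF J]]
      by (simp add: h[OF I] h[OF J] idl_extend_genideal[OF assms])
  qed
  have "?h \<in> carrier (Idl A) \<rightarrow>\<^sub>E carrier Q"
    by (rule PiE_I) (use hc in \<open>auto simp: idl_extend_def\<close>)
  then show ?thesis
    unfolding iquant_hom_def using join one mult by (simp del: Idl_simps(2))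
qed

section \<open>The unit of the adjunction\<close>

lemma Idl_unit_osr_sa_hom:
  assumes "ordered_semiring A"
  shows "Idl_unit A \<in> osr_sa_hom A (osr_of_quant (Idl A))"
proof -
  interpret A: ordered_semiring A by fact
  have gen: "osr_ideal A (osr_genideal A S)" if "S \<subseteq> carrier A" for S
    by (rule A.osr_ideal_genideal[OF that])
  have mem: "x \<in> osr_genideal A S" if "x \<in> S" for x S
    using that subset_osr_genideal[of S A] by auto
  have mono: "osr_genideal A {x} \<subseteq> osr_genideal A {y}"
    if "x \<in> carrier A" "y \<in> carrier A" "x \<preceq>\<^bsub>A\<^esub> y" for x y
    using that osr_ideal_le[OF gen mem, of "{y}" y x] by (intro osr_genideal_least gen) auto
  \<comment> \<open>The bottom element is the empty join, hence the ideal generated by the empty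
    set; it already contains zero.\<close>
  have bot: "\<bottom>\<^bsub>quant_order (Idl A)\<^esub> = osr_genideal A {}"
    using integral_quantale.axioms(1)[OF A.integral_quantale_Idl, THEN quantale.bottom_eq_join]
      A.Idl_join[of "{}"] by simp
  have zero: "osr_genideal A {\<zero>\<^bsub>A\<^esub>} \<subseteq> osr_genideal A {}"
    by (intro osr_genideal_least gen) (auto intro: osr_ideal_zero gen)
  have one: "osr_genideal A {\<one>\<^bsub>A\<^esub>} = carrier A"
  proof
    show "carrier A \<subseteq> osr_genideal A {\<one>\<^bsub>A\<^esub>}"
      using osr_ideal_mult[OF gen mem, of "{\<one>\<^bsub>A\<^esub>}" "\<one>\<^bsub>A\<^esub>"] by auto
  qed (use osr_ideal_subset[OF gen] in simp)
  \<comment> \<open>Only an inclusion can be expected: in a ring ordered by equality, x and -x sum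
    to zero, whose ideal need not contain x. This is why the morphisms are subadditive.\<close>
  have add: "osr_genideal A {x \<oplus>\<^bsub>A\<^esub> y}
      \<subseteq> osr_genideal A {x} \<squnion>\<^bsub>quant_order (Idl A)\<^esub> osr_genideal A {y}"
    if x: "x \<in> carrier A" and y: "y \<in> carrier A" for x y
  proof -
    let ?U = "osr_genideal A {x} \<union> osr_genideal A {y}"
    have U: "osr_ideal A (osr_genideal A ?U)"
      using osr_ideal_subset[OF gen, of "{x}"] osr_ideal_subset[OF gen, of "{y}"] x y
      by (intro gen) auto
    have "x \<oplus>\<^bsub>A\<^esub> y \<in> osr_genideal A ?U"
      by (intro osr_ideal_add[OF U] mem) (auto intro: mem)
    then have "osr_genideal A {x \<oplus>\<^bsub>A\<^esub> y} \<subseteq> osr_genideal A ?U"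
      by (intro osr_genideal_least U) auto
    then show ?thesis
      using A.Idl_join[of "{osr_genideal A {x}, osr_genideal A {y}}"] gen x y by (simp add: join_def)
  qed
  have mult: "osr_genideal A {x \<otimes>\<^bsub>A\<^esub> y} = osr_genideal A {x} \<otimes>\<^bsub>Idl A\<^esub> osr_genideal A {y}"
    if "x \<in> carrier A" "y \<in> carrier A" for x y
    using A.osr_genideal_mult[of "{x}" "{y}"] that by simp
  show ?thesis
    unfolding osr_sa_hom_def using gen mono zero one add mult
    by (auto simp: Idl_unit_def bot simp del: Idl_simps(2))
qed

section \<open>Functoriality of ideals\<close>

lemma Idl_map_eq_extend:
  assumes "ordered_semiring A" "ordered_semiring B" and f: "f \<in> osr_sa_hom A B"
  shows "Idl_map A B f = idl_extend A (Idl B) (compose (carrier A) (Idl_unit B) f)"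
proof -
  interpret B: ordered_semiring B by fact
  have "osr_genideal B (f ` I)
      = \<Squnion>\<^bsub>quant_order (Idl B)\<^esub> (compose (carrier A) (Idl_unit B) f ` I)"
    if I: "osr_ideal A I" for I
  proof -
    note fI = osr_sa_hom_closed[OF f osr_ideal_subset[OF I, THEN subsetD]]
    have img: "compose (carrier A) (Idl_unit B) f ` I = (\<lambda>x. osr_genideal B {f x}) ` I"
      using fI osr_ideal_subset[OF I]
      by (intro image_cong) (auto simp: compose_eq Idl_unit_def)
    have F: "(\<lambda>x. osr_genideal B {f x}) ` I \<subseteq> carrier (Idl B)"
      using fI by (auto intro: B.osr_ideal_genideal)
    have U: "(\<Union>x\<in>I. osr_genideal B {f x}) \<subseteq> carrier B"
      using F osr_ideal_subset by fastforce
    \<comment> \<open>The ideal generated by the image is the join of the principal ideals of its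
      elements, that is, of the values of the unit after \<open>f\<close>.\<close>
    have "osr_genideal B (f ` I) = osr_genideal B (\<Union>x\<in>I. osr_genideal B {f x})"
    proof
      show "osr_genideal B (f ` I) \<subseteq> osr_genideal B (\<Union>x\<in>I. osr_genideal B {f x})"
        by (rule B.osr_genideal_mono[OF _ U]) (use subset_osr_genideal in fastforce)
      have fIc: "f ` I \<subseteq> carrier B" using fI by auto
      have "osr_genideal B {f x} \<subseteq> osr_genideal B (f ` I)" if "x \<in> I" for x
        by (rule B.osr_genideal_mono[OF _ fIc]) (use that in auto)
      then show "osr_genideal B (\<Union>x\<in>I. osr_genideal B {f x}) \<subseteq> osr_genideal B (f ` I)"
        by (intro osr_genideal_least B.osr_ideal_genideal fIc) auto
    qed
    then show ?thesis by (simp add: img B.Idl_join[OF F])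
  qed
  then show ?thesis
    unfolding Idl_map_def idl_extend_def by (intro restrict_ext) simp
qed

text \<open>Since \<open>Idl_map\<close> is the extension of the unit after \<open>f\<close>,
  preservation of joins, unit and products is inherited from
  \<open>idl_extend_iquant_hom\<close>.\<close>

lemma Idl_map_iquant_hom:
  assumes "ordered_semiring A" "ordered_semiring B" and "f \<in> osr_sa_hom A B"
  shows "Idl_map A B f \<in> iquant_hom (Idl A) (Idl B)"
proof -
  have I: "integral_quantale (Idl B)"
    using assms(2) by (rule ordered_semiring.integral_quantale_Idl)
  then have "ordered_semiring (osr_of_quant (Idl B))"
    by (intro quantale.ordered_semiring_osr_of_quant integral_quantale.axioms(1))
  then show ?thesis
    unfolding Idl_map_eq_extend[OF assms] using assms I
    by (intro idl_extend_iquant_hom osr_sa_hom_compose[of A B] Idl_unit_osr_sa_hom)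
qed

lemma Idl_map_identity:
  assumes "ordered_semiring A"
  shows "Idl_map A A (identity_on (carrier A)) = identity_on (carrier (Idl A))"
  unfolding Idl_map_def
proof (rule restrict_ext)
  fix I assume "I \<in> carrier (Idl A)"
  then have I: "osr_ideal A I" by simp
  have "identity_on (carrier A) ` I = I" using osr_ideal_subset[OF I] by force
  then show "osr_genideal A (identity_on (carrier A) ` I) = I"
    using I by (simp add: osr_genideal_ideal)
qed

lemma Idl_map_compose:
  assumes "ordered_semiring A" "ordered_semiring B" "ordered_semiring C"
    and f: "f \<in> osr_sa_hom A B" and g: "g \<in> osr_sa_hom B C"
  shows "Idl_map A C (compose (carrier A) g f)
    = compose (carrier (Idl A)) (Idl_map B C g) (Idl_map A B f)"
  unfolding compose_def[of "carrier (Idl A)"] Idl_map_def[of A C]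
proof (rule restrict_ext)
  fix I assume "I \<in> carrier (Idl A)"
  then have I: "osr_ideal A I" by simp
  have fI: "f ` I \<subseteq> carrier B"
    using osr_sa_hom_closed[OF f] osr_ideal_subset[OF I] by auto
  have "compose (carrier A) g f ` I = g ` f ` I"
    unfolding image_image using osr_ideal_subset[OF I]
    by (intro image_cong) (auto simp: compose_eq)
  then show "osr_genideal C (compose (carrier A) g f ` I) = Idl_map B C g (Idl_map A B f I)"
    using osr_genideal_image_genideal[OF assms(2,3) g fI] I
      ordered_semiring.osr_ideal_genideal[OF assms(2) fI]
    by (simp add: Idl_map_def)
qed

section \<open>The transposition bijection\<close>

lemma Idl_transpose_apply:
  "a \<in> carrier A \<Longrightarrow> Idl_transpose A h a = h (osr_genideal A {a})"
  by (simp add: Idl_transpose_def compose_eq Idl_unit_def)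

lemma Idl_transpose_extend:
  assumes "ordered_semiring A" "integral_quantale Q"
    and f: "f \<in> osr_sa_hom A (osr_of_quant Q)"
  shows "Idl_transpose A (idl_extend A Q f) = f"
proof (rule extensionalityI[of _ "carrier A"])
  interpret Q: integral_quantale Q by fact
  show "Idl_transpose A (idl_extend A Q f) \<in> extensional (carrier A)"
    by (simp add: Idl_transpose_def)
  show "f \<in> extensional (carrier A)"
    using f by (auto simp: osr_sa_hom_def PiE_def)
  \<comment> \<open>On the principal ideal of \<open>a\<close>, the extension is the join of the
    single value \<open>f a\<close>.\<close>
  fix a assume a: "a \<in> carrier A"
  then have "f a \<in> carrier Q" using osr_sa_hom_closed[OF f] by simp
  then have "\<Squnion>\<^bsub>quant_order Q\<^esub> {f a} = f a"
    by (intro Q.join_eqI) (auto intro: Q.quant_refl)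
  then show "Idl_transpose A (idl_extend A Q f) a = f a"
    using a by (simp add: Idl_transpose_apply idl_extend_genideal[OF assms])
qed

lemma idl_extend_transpose:
  assumes "ordered_semiring A" and h: "h \<in> iquant_hom (Idl A) Q"
  shows "idl_extend A Q (Idl_transpose A h) = h"
proof (rule extensionalityI[of _ "carrier (Idl A)"])
  interpret A: ordered_semiring A by fact
  show "idl_extend A Q (Idl_transpose A h) \<in> extensional (carrier (Idl A))"
    by (simp add: idl_extend_def)
  show "h \<in> extensional (carrier (Idl A))"
    using h by (auto simp: iquant_hom_def PiE_def)
  fix I assume Ic: "I \<in> carrier (Idl A)"
  then have I: "osr_ideal A I" by simp
  \<comment> \<open>The union of these principal ideals is already \<open>I\<close>, so the closure
    taken in \<open>Idl_join\<close> leaves it unchanged.\<close>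
  let ?F = "(\<lambda>a. osr_genideal A {a}) ` I"
  have F: "?F \<subseteq> carrier (Idl A)"
    using osr_ideal_subset[OF I] by (auto intro: A.osr_ideal_genideal)
  have "\<Union>?F = I"
  proof
    show "\<Union>?F \<subseteq> I"
      using osr_genideal_least[OF I] by (simp add: UN_subset_iff)
    have "a \<in> osr_genideal A {a}" for a
      using subset_osr_genideal[of "{a}" A] by simp
    then show "I \<subseteq> \<Union>?F" by blast
  qed
  then have "\<Squnion>\<^bsub>quant_order (Idl A)\<^esub> ?F = I"
    by (simp add: A.Idl_join[OF F] osr_genideal_ideal[OF I])
  then have "h I = \<Squnion>\<^bsub>quant_order Q\<^esub> (h ` ?F)"
    using iquant_hom_join[OF h F] by simp
  also have "h ` ?F = Idl_transpose A h ` I"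
    unfolding image_image using osr_ideal_subset[OF I]
    by (intro image_cong) (auto simp: Idl_transpose_apply)
  finally show "idl_extend A Q (Idl_transpose A h) I = h I"
    using Ic by (simp add: idl_extend_def)
qed

text \<open>The inclusion turns \<open>h\<close> into a subadditive morphism, and transposition
  composes it with the unit.\<close>

lemma Idl_transpose_osr_sa_hom:
  assumes "ordered_semiring A" "integral_quantale Q" and h: "h \<in> iquant_hom (Idl A) Q"
  shows "Idl_transpose A h \<in> osr_sa_hom A (osr_of_quant Q)"
proof -
  have qA: "quantale (Idl A)" and qQ: "quantale Q"
    using assms(1,2) ordered_semiring.integral_quantale_Idl integral_quantale.axioms(1) by blast+
  show ?thesis
    unfolding Idl_transpose_def
    by (rule osr_sa_hom_compose[of A "osr_of_quant (Idl A)"])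
      (use assms(1) h Idl_unit_osr_sa_hom iquant_hom_subset_osr_sa_hom[OF qA qQ]
        quantale.ordered_semiring_osr_of_quant[OF qA] quantale.ordered_semiring_osr_of_quant[OF qQ]
        in auto)
qed

lemma Idl_transpose_bij_betw:
  assumes "ordered_semiring A" "integral_quantale Q"
  shows "bij_betw (Idl_transpose A) (iquant_hom (Idl A) Q) (osr_sa_hom A (osr_of_quant Q))"
  by (rule bij_betwI[where g = "idl_extend A Q"])
    (use assms in \<open>auto intro: Idl_transpose_osr_sa_hom idl_extend_iquant_hom
      idl_extend_transpose Idl_transpose_extend\<close>)

section \<open>Naturality of the transposition\<close>

lemma Idl_transpose_natural_left:
  assumes "ordered_semiring A" "ordered_semiring B" and f: "f \<in> osr_sa_hom A B"
  shows "Idl_transpose A (compose (carrier (Idl A)) h (Idl_map A B f))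
    = compose (carrier A) (Idl_transpose B h) f"
proof (rule extensionalityI[of _ "carrier A"])
  \<comment> \<open>Both sides apply \<open>h\<close> to an ideal of \<open>B\<close>: one generated
    by the image of the principal ideal of \<open>a\<close>, the other by \<open>f a\<close> alone.
    The two ideals coincide.\<close>
  fix a assume a: "a \<in> carrier A"
  then have "osr_ideal A (osr_genideal A {a})"
    using ordered_semiring.osr_ideal_genideal[OF assms(1)] by simp
  then show "Idl_transpose A (compose (carrier (Idl A)) h (Idl_map A B f)) a
      = compose (carrier A) (Idl_transpose B h) f a"
    using a osr_sa_hom_closed[OF f a] osr_genideal_image_genideal[OF assms, of "{a}"]
    by (simp add: Idl_transpose_apply compose_eq Idl_map_def)
qed (simp_all add: Idl_transpose_def)

lemma Idl_transpose_natural_right: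
  assumes "ordered_semiring A"
  shows "Idl_transpose A (compose (carrier (Idl A)) k h)
    = compose (carrier A) k (Idl_transpose A h)"
proof (rule extensionalityI[of _ "carrier A"])
  fix a assume a: "a \<in> carrier A"
  then have "osr_ideal A (osr_genideal A {a})"
    using ordered_semiring.osr_ideal_genideal[OF assms] by simp
  then show "Idl_transpose A (compose (carrier (Idl A)) k h) a
      = compose (carrier A) k (Idl_transpose A h) a"
    using a by (simp add: Idl_transpose_apply compose_eq)
qed (simp_all add: Idl_transpose_def)

text \<open>The adjunction is expressed as a hom-set bijection natural in both arguments. Separate
  type variables allow the objects involved to live over different types.\<close>

theorem corollary4p5:
  shows
    \<comment> \<open>the inclusion is a functor, acting as the identity on morphisms\<close>
    "(\<forall>Q::'p quant. integral_quantale Q \<longrightarrow>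
        ordered_semiring (osr_of_quant Q)
        \<and> identity_on (carrier Q) = identity_on (carrier (osr_of_quant Q)))
   \<and> (\<forall>(P::'p quant) (Q::'q quant). integral_quantale P \<longrightarrow> integral_quantale Q \<longrightarrow>
        iquant_hom P Q \<subseteq> osr_sa_hom (osr_of_quant P) (osr_of_quant Q))
   \<and> (\<forall>(P::'p quant) (Q::'q quant) (R::'r quant).
        integral_quantale P \<longrightarrow> integral_quantale Q \<longrightarrow> integral_quantale R \<longrightarrow>
        (\<forall>h \<in> iquant_hom P Q. \<forall>k \<in> iquant_hom Q R.
          compose (carrier P) k h = compose (carrier (osr_of_quant P)) k h))
   \<and> \<comment> \<open>the ideals form a functor from ordered semirings to integral quantales\<close>
     (\<forall>A::'a osr. ordered_semiring A \<longrightarrow>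
        integral_quantale (Idl A)
        \<and> Idl_map A A (identity_on (carrier A)) = identity_on (carrier (Idl A)))
   \<and> (\<forall>(A::'a osr) (B::'b osr). ordered_semiring A \<longrightarrow> ordered_semiring B \<longrightarrow>
        (\<forall>f \<in> osr_sa_hom A B. Idl_map A B f \<in> iquant_hom (Idl A) (Idl B)))
   \<and> (\<forall>(A::'a osr) (B::'b osr) (C::'c osr).
        ordered_semiring A \<longrightarrow> ordered_semiring B \<longrightarrow> ordered_semiring C \<longrightarrow>
        (\<forall>f \<in> osr_sa_hom A B. \<forall>g \<in> osr_sa_hom B C.
          Idl_map A C (compose (carrier A) g f)
            = compose (carrier (Idl A)) (Idl_map B C g) (Idl_map A B f)))
   \<and> \<comment> \<open>bijection of hom-sets\<close>
     (\<forall>(A::'a osr) (Q::'q quant). ordered_semiring A \<longrightarrow> integral_quantale Q \<longrightarrow>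
        bij_betw (Idl_transpose A) (iquant_hom (Idl A) Q) (osr_sa_hom A (osr_of_quant Q)))
   \<and> \<comment> \<open>naturality in the ordered semiring\<close>
     (\<forall>(A::'a osr) (B::'b osr) (Q::'q quant).
        ordered_semiring A \<longrightarrow> ordered_semiring B \<longrightarrow> integral_quantale Q \<longrightarrow>
        (\<forall>f \<in> osr_sa_hom A B. \<forall>h \<in> iquant_hom (Idl B) Q.
          Idl_transpose A (compose (carrier (Idl A)) h (Idl_map A B f))
            = compose (carrier A) (Idl_transpose B h) f))
   \<and> \<comment> \<open>naturality in the integral quantale\<close>
     (\<forall>(A::'a osr) (P::'p quant) (Q::'q quant).
        ordered_semiring A \<longrightarrow> integral_quantale P \<longrightarrow> integral_quantale Q \<longrightarrow>
        (\<forall>h \<in> iquant_hom (Idl A) P. \<forall>k \<in> iquant_hom P Q.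
          Idl_transpose A (compose (carrier (Idl A)) k h)
            = compose (carrier A) k (Idl_transpose A h)))"
  by (intro conjI allI impI ballI)
    (simp add: integral_quantale.axioms(1) quantale.ordered_semiring_osr_of_quant
      iquant_hom_subset_osr_sa_hom ordered_semiring.integral_quantale_Idl Idl_map_identity; fail
    | (rule Idl_map_iquant_hom Idl_map_compose Idl_transpose_bij_betw Idl_transpose_natural_left
      Idl_transpose_natural_right; assumption))+

end
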